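(* Let $n\ge 2$, let $(G,\cdot)$ be a group, let $\theta\in Aut(G,\cdot)$ and $b\in G$ satisfy $\theta(b)=b$ and $\theta^{n-1}(x)=bxb^{-1}$ for all $x\in G$, and let $(G,f)=der_{\theta,b}(G,\cdot)$ be the $n$-ary group with $f(x_1,\ldots,x_n)=x_1\theta(x_2)\theta^2(x_3)\cdots\theta^{n-1}(x_n)b$. Then $$Aut(G,f)=\{R_a\phi : a\in G,\ \phi\in Aut(G,\cdot),\ f(\underbrace{a,\ldots,a}_{n})=\phi(b)a,\ [\theta,\phi]=I_a\}.$$
   Context: For $a\in G$, $R_a:G\to G$ is the right translation $R_a(x)=xa$, and $I_a$ is the inner automorphism $I_a(x)=a^{-1}xa$ of $(G,\cdot)$. Products of maps are compositions, so $(R_a\phi)(x)=\phi(x)a$. The bracket is the commutator $[\theta,\phi]=\theta\phi\theta^{-1}\phi^{-1}$ in $Aut(G,\cdot)$. $Aut(G,f)$ is the group of all bijections $\psi:G\to G$ with $\psi(f(x_1,\ldots,x_n))=f(\psi(x_1),\ldots,\psi(x_n))$ for all $x_1,\ldots,x_n\in G$. *)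

theory Defs
  imports "HOL-Algebra.Bij"
begin

text \<open>
  An n-ary operation on \<open>carrier G\<close> is a function on lists, of which only the values on lists of
  length n with entries in \<open>carrier G\<close> matter. Automorphisms are the elements of \<open>auto G\<close>, that
  is, they are extensional (\<open>undefined\<close> off the carrier); all maps below follow this convention,
  so that equality of maps is equality on the carrier. In \<open>AutoGroup G\<close> the product is
  \<open>(\<theta> \<phi>) x = \<theta> (\<phi> x)\<close>.
\<close>

text \<open>\<open>x\<^sub>1 \<cdot> \<theta> x\<^sub>2 \<cdot> \<theta>\<^sup>2 x\<^sub>3 \<cdots> \<theta>\<^sup>n\<^sup>-\<^sup>1 x\<^sub>n \<cdot> b\<close>; the arity n is the length of the list, whose indices start at 0.\<close>
definition der_op :: "('a, 'm) monoid_scheme \<Rightarrow> ('a \<Rightarrow> 'a) \<Rightarrow> 'a \<Rightarrow> 'a list \<Rightarrow> 'a" where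
  "der_op G \<theta> b xs =
     foldr (mult G) (map (\<lambda>i. (\<theta> ^^ i) (xs ! i)) [0..<length xs]) \<one>\<^bsub>G\<^esub> \<otimes>\<^bsub>G\<^esub> b"

definition nary_auto :: "nat \<Rightarrow> 'a set \<Rightarrow> ('a list \<Rightarrow> 'a) \<Rightarrow> ('a \<Rightarrow> 'a) set" where
  "nary_auto n S f =
     {\<psi> \<in> Bij S. \<forall>xs. length xs = n \<and> set xs \<subseteq> S \<longrightarrow> \<psi> (f xs) = f (map \<psi> xs)}"

definition right_translation :: "('a, 'm) monoid_scheme \<Rightarrow> 'a \<Rightarrow> 'a \<Rightarrow> 'a" where
  "right_translation G a = (\<lambda>x\<in>carrier G. x \<otimes>\<^bsub>G\<^esub> a)"

definition inner_auto :: "('a, 'm) monoid_scheme \<Rightarrow> 'a \<Rightarrow> 'a \<Rightarrow> 'a" where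
  "inner_auto G a = (\<lambda>x\<in>carrier G. inv\<^bsub>G\<^esub> a \<otimes>\<^bsub>G\<^esub> x \<otimes>\<^bsub>G\<^esub> a)"

text \<open>There are two opposite conventions for commutators; this one is \<open>[x, y] = x y x\<inverse> y\<inverse>\<close>.\<close>
definition commutator :: "('a, 'm) monoid_scheme \<Rightarrow> 'a \<Rightarrow> 'a \<Rightarrow> 'a" where
  "commutator H x y = x \<otimes>\<^bsub>H\<^esub> y \<otimes>\<^bsub>H\<^esub> inv\<^bsub>H\<^esub> x \<otimes>\<^bsub>H\<^esub> inv\<^bsub>H\<^esub> y"

end

theory Submission
  imports Defs
begin

text \<open>
  Put \<open>\<psi> x = \<phi> x \<cdot> a\<close> with \<open>\<phi> \<one> = \<one>\<close>. If \<open>\<psi>\<close> preserves f, then evaluating f at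
  \<open>(x, y, \<one>, \<dots>, \<one>)\<close> gives \<open>\<phi> (x \<cdot> \<theta> y \<cdot> b) = \<phi> x \<cdot> (a \<cdot> \<theta> (\<phi> y) \<cdot> a\<inverse>) \<cdot> \<phi> b\<close>. For
  \<open>x = \<one>\<close> this makes the last two factors \<open>\<phi> (\<theta> y \<cdot> b)\<close>, so \<open>\<phi>\<close> is a homomorphism because
  every element has the form \<open>\<theta> y \<cdot> b\<close>; then \<open>\<phi> (\<theta> y) = a \<cdot> \<theta> (\<phi> y) \<cdot> a\<inverse>\<close>. Conversely, this
  relation iterates to \<open>\<phi> (\<theta>\<^sup>i x) \<cdot> A\<^sub>i = A\<^sub>i \<cdot> \<theta>\<^sup>i (\<phi> x)\<close> with
  \<open>A\<^sub>i = a \<cdot> \<theta> a \<cdots> \<theta>\<^sup>i\<^sup>-\<^sup>1 a\<close>, which moves all the factors \<open>\<theta>\<^sup>i a\<close> to the right.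
\<close>

section \<open>Products twisted by the powers of a map\<close>

text \<open>The entries are a family indexed by \<open>nat\<close>, with the length separate, so
  that an induction on \<open>k\<close> adds a factor at the right end and leaves the earlier
  exponents alone. The constant family \<open>a\<close> gives the elements \<open>A\<^sub>i\<close>
  described above.\<close>

definition twisted_prod :: "('a, 'm) monoid_scheme \<Rightarrow> ('a \<Rightarrow> 'a) \<Rightarrow> (nat \<Rightarrow> 'a) \<Rightarrow> nat \<Rightarrow> 'a" where
  "twisted_prod G \<theta> x k = foldr (mult G) (map (\<lambda>i. (\<theta> ^^ i) (x i)) [0..<k]) \<one>\<^bsub>G\<^esub>"

lemma der_op_eq_twisted_prod:
  "der_op G \<theta> b xs = twisted_prod G \<theta> ((!) xs) (length xs) \<otimes>\<^bsub>G\<^esub> b"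
  by (simp add: der_op_def twisted_prod_def)

lemma twisted_prod_cong:
  assumes "\<And>i. i < k \<Longrightarrow> x i = y i"
  shows "twisted_prod G \<theta> x k = twisted_prod G \<theta> y k"
proof -
  have "map (\<lambda>i. (\<theta> ^^ i) (x i)) [0..<k] = map (\<lambda>i. (\<theta> ^^ i) (y i)) [0..<k]"
    using assms by simp
  then show ?thesis by (simp only: twisted_prod_def)
qed

lemma twisted_prod_0 [simp]: "twisted_prod G \<theta> x 0 = \<one>\<^bsub>G\<^esub>"
  by (simp add: twisted_prod_def)

section \<open>Automorphisms of a group and their powers\<close>

lemma autoD:
  assumes "\<phi> \<in> auto G"
  shows auto_closed: "x \<in> carrier G \<Longrightarrow> \<phi> x \<in> carrier G"
    and auto_mult: "x \<in> carrier G \<Longrightarrow> y \<in> carrier G \<Longrightarrow> \<phi> (x \<otimes>\<^bsub>G\<^esub> y) = \<phi> x \<otimes>\<^bsub>G\<^esub> \<phi> y"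
    and auto_Bij: "\<phi> \<in> Bij (carrier G)"
    and auto_bij_betw: "bij_betw \<phi> (carrier G) (carrier G)"
  using assms by (auto simp: auto_def Bij_def hom_def)

context group
begin

lemma auto_one:
  assumes "\<phi> \<in> auto G"
  shows "\<phi> \<one> = \<one>"
proof -
  have "\<phi> \<one> \<otimes> \<phi> \<one> = \<phi> \<one>"
    using auto_mult[OF assms, of \<one> \<one>] by simp
  then show ?thesis
    using auto_closed[OF assms] by (metis l_cancel_one one_closed)
qed

lemma funpow_auto_closed:
  assumes "\<theta> \<in> auto G" "x \<in> carrier G"
  shows "(\<theta> ^^ i) x \<in> carrier G"
  by (induction i) (use assms in \<open>auto simp: auto_closed\<close>)

lemma funpow_auto_mult:
  assumes "\<theta> \<in> auto G" "x \<in> carrier G" "y \<in> carrier G"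
  shows "(\<theta> ^^ i) (x \<otimes> y) = (\<theta> ^^ i) x \<otimes> (\<theta> ^^ i) y"
  by (induction i) (use assms in \<open>auto simp: auto_mult funpow_auto_closed\<close>)

lemma funpow_auto_one:
  assumes "\<theta> \<in> auto G"
  shows "(\<theta> ^^ i) \<one> = \<one>"
  by (induction i) (use assms in \<open>auto simp: auto_one\<close>)

section \<open>Ordered products of group elements\<close>

lemma foldr_mult_closed:
  assumes "set xs \<subseteq> carrier G"
  shows "foldr (\<otimes>) xs \<one> \<in> carrier G"
  using assms by (induction xs) auto

text \<open>A right fold peels off first factors; moving the start value out of it is what lets
  \<open>twisted_prod_Suc\<close> split off the last factor instead.\<close>

lemma foldr_mult_append:
  assumes "set xs \<subseteq> carrier G" "y \<in> carrier G"
  shows "foldr (\<otimes>) xs y = foldr (\<otimes>) xs \<one> \<otimes> y"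
  using assms by (induction xs) (auto simp: m_assoc foldr_mult_closed)

lemma twisted_prod_closed:
  assumes "\<theta> \<in> auto G" "\<And>i. i < k \<Longrightarrow> x i \<in> carrier G"
  shows "twisted_prod G \<theta> x k \<in> carrier G"
  unfolding twisted_prod_def
  by (rule foldr_mult_closed) (use assms in \<open>auto simp: funpow_auto_closed\<close>)

lemma twisted_prod_Suc:
  assumes "\<theta> \<in> auto G" "\<And>i. i < Suc k \<Longrightarrow> x i \<in> carrier G"
  shows "twisted_prod G \<theta> x (Suc k) = twisted_prod G \<theta> x k \<otimes> (\<theta> ^^ k) (x k)"
proof -
  have "set (map (\<lambda>i. (\<theta> ^^ i) (x i)) [0..<k]) \<subseteq> carrier G" "(\<theta> ^^ k) (x k) \<in> carrier G"
    using assms by (auto simp: funpow_auto_closed)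
  then show ?thesis
    unfolding twisted_prod_def by (simp add: foldr_mult_append[of _ "(\<theta> ^^ k) (x k)"])
qed

lemma foldr_mult_ones: "foldr (\<otimes>) (replicate k \<one>) \<one> = \<one>"
  by (induction k) auto

text \<open>Two free places suffice later, so all remaining factors and \<open>b\<close> are merged
  into one element \<open>q\<close> independent of \<open>x\<close> and \<open>y\<close>. For
  \<open>c = \<one>\<close> its value is needed; for any other \<open>c\<close> only its existence
  is.\<close>

lemma der_op_two_then_const:
  assumes "\<theta> \<in> auto G" "c \<in> carrier G" "b \<in> carrier G"
  obtains q where "q \<in> carrier G" "c = \<one> \<Longrightarrow> q = b"
    "\<And>x y. x \<in> carrier G \<Longrightarrow> y \<in> carrier G \<Longrightarrow>
       der_op G \<theta> b (x # y # replicate m c) = x \<otimes> \<theta> y \<otimes> q"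
proof -
  \<comment> \<open>The entries \<open>c\<close> occupy the indices from 2 to \<open>m + 1\<close>,
    which are also their exponents.\<close>
  define Q where "Q = map (\<lambda>i. (\<theta> ^^ i) c) [2..<Suc (Suc m)]"
  have Q: "foldr (\<otimes>) Q \<one> \<in> carrier G"
    by (rule foldr_mult_closed) (use assms in \<open>auto simp: Q_def funpow_auto_closed simp del: upt_Suc\<close>)
  have ones: "foldr (\<otimes>) Q \<one> = \<one>" if "c = \<one>"
  proof -
    have "Q = replicate m \<one>"
      using that assms(1) by (auto simp: Q_def funpow_auto_one map_replicate_const simp del: upt_Suc)
    then show ?thesis by (simp only: foldr_mult_ones)
  qed
  have "der_op G \<theta> b (x # y # replicate m c) = x \<otimes> \<theta> y \<otimes> (foldr (\<otimes>) Q \<one> \<otimes> b)"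
    if "x \<in> carrier G" "y \<in> carrier G" for x y
  proof -
    let ?xs = "x # y # replicate m c"
    have upt: "[0..<length ?xs] = 0 # 1 # [2..<Suc (Suc m)]"
      by (simp add: upt_conv_Cons numeral_2_eq_2 del: upt_Suc)
    have "map (\<lambda>i. (\<theta> ^^ i) (?xs ! i)) [2..<Suc (Suc m)] = Q"
      unfolding Q_def by (rule map_cong) (auto simp: nth_Cons' simp del: upt_Suc)
    then have "map (\<lambda>i. (\<theta> ^^ i) (?xs ! i)) [0..<length ?xs] = x # \<theta> y # Q"
      unfolding upt by simp
    then show ?thesis
      unfolding der_op_def using that assms Q by (simp add: m_assoc auto_closed)
  qed
  then show thesis
    using that[of "foldr (\<otimes>) Q \<one> \<otimes> b"] Q ones assms by simp
qed

section \<open>Right translations, inner automorphisms and commutators\<close>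

lemma right_translation_Bij:
  assumes "a \<in> carrier G"
  shows "right_translation G a \<in> Bij (carrier G)"
proof -
  have "bij_betw (\<lambda>x. x \<otimes> a) (carrier G) (carrier G)"
    using assms
    by (intro bij_betw_byWitness[where f' = "\<lambda>x. x \<otimes> inv a"]) (auto simp: m_assoc)
  then show ?thesis
    by (auto simp: Bij_def right_translation_def)
qed

text \<open>This makes \<open>inner_auto G a\<close> an element of \<open>AutoGroup G\<close>, so
  that the commutator equation can be solved inside that group.\<close>

lemma inner_auto_in_auto:
  assumes "a \<in> carrier G"
  shows "inner_auto G a \<in> auto G"
proof -
  have cancel: "a \<otimes> (inv a \<otimes> x) = x" "inv a \<otimes> (a \<otimes> x) = x" if "x \<in> carrier G" for x
    using that assms by (simp_all flip: m_assoc)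
  have "bij_betw (\<lambda>x. inv a \<otimes> x \<otimes> a) (carrier G) (carrier G)"
    using assms
    by (intro bij_betw_byWitness[where f' = "\<lambda>x. a \<otimes> x \<otimes> inv a"])
       (auto simp: m_assoc cancel)
  then have "inner_auto G a \<in> Bij (carrier G)"
    by (auto simp: Bij_def inner_auto_def)
  moreover have "inner_auto G a \<in> hom G G"
  proof (rule homI)
    fix x y assume xy: "x \<in> carrier G" "y \<in> carrier G"
    then have "inv a \<otimes> (x \<otimes> y) \<otimes> a = (inv a \<otimes> x \<otimes> a) \<otimes> (inv a \<otimes> y \<otimes> a)"
      using assms by (simp add: m_assoc cancel)
    then show "inner_auto G a (x \<otimes> y) = inner_auto G a x \<otimes> inner_auto G a y"
      using xy by (simp add: inner_auto_def)
  qed (use assms in \<open>simp add: inner_auto_def\<close>)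
  ultimately show ?thesis by (simp add: auto_def)
qed

text \<open>The last two factors of the commutator form \<open>inv (y \<otimes> x)\<close>, so
  multiplying by \<open>y \<otimes> x\<close> removes all inverses. It is applied to the group
  \<open>AutoGroup G\<close>.\<close>

lemma commutator_eq_iff:
  assumes "x \<in> carrier G" "y \<in> carrier G" "z \<in> carrier G"
  shows "commutator G x y = z \<longleftrightarrow> x \<otimes> y = z \<otimes> (y \<otimes> x)"
proof -
  have "commutator G x y = x \<otimes> y \<otimes> inv (y \<otimes> x)"
    using assms by (simp add: commutator_def inv_mult_group m_assoc)
  then show ?thesis
    using assms by (metis inv_solve_right' m_closed)
qed

text \<open>Turns the commutator condition into a pointwise identity in \<open>G\<close> that avoids
  inverse automorphisms and can be used in calculations with products.\<close>

lemma commutator_eq_inner_auto_iff: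
  assumes "\<theta> \<in> auto G" "\<phi> \<in> auto G" "a \<in> carrier G"
  shows "commutator (AutoGroup G) \<theta> \<phi> = inner_auto G a \<longleftrightarrow>
    (\<forall>x\<in>carrier G. \<phi> (\<theta> x) \<otimes> a = a \<otimes> \<theta> (\<phi> x))"
proof -
  let ?C = "carrier G"
  interpret A: group "AutoGroup G" by (rule AutoGroup)
  \<comment> \<open>The product of \<open>BijGroup\<close> is a restricted function, so it is
    unfolded to \<open>compose\<close> only for bijections of the carrier.\<close>
  have mult: "\<alpha> \<otimes>\<^bsub>AutoGroup G\<^esub> \<beta> = compose ?C \<alpha> \<beta>" if "\<alpha> \<in> auto G" "\<beta> \<in> auto G" for \<alpha> \<beta>
    using that[THEN auto_Bij] by (simp add: AutoGroup_def BijGroup_def)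
  have carr: "carrier (AutoGroup G) = auto G"
    by (simp add: AutoGroup_def)
  note I = inner_auto_in_auto[OF assms(3)]
  have \<phi>\<theta>: "compose ?C \<phi> \<theta> \<in> auto G"
    using A.m_closed[of \<phi> \<theta>] assms mult carr by simp
  have "commutator (AutoGroup G) \<theta> \<phi> = inner_auto G a \<longleftrightarrow>
    compose ?C \<theta> \<phi> = compose ?C (inner_auto G a) (compose ?C \<phi> \<theta>)"
    using A.commutator_eq_iff[of \<theta> \<phi> "inner_auto G a"] assms I \<phi>\<theta> by (simp add: carr mult)
  \<comment> \<open>Both composites are \<open>undefined\<close> off the carrier, so their equality
    is equality on it.\<close>
  also have "\<dots> \<longleftrightarrow> (\<forall>x\<in>?C. \<theta> (\<phi> x) = inv a \<otimes> \<phi> (\<theta> x) \<otimes> a)"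
    using assms by (auto simp: fun_eq_iff compose_def inner_auto_def auto_closed restrict_def)
  also have "\<dots> \<longleftrightarrow> (\<forall>x\<in>?C. \<phi> (\<theta> x) \<otimes> a = a \<otimes> \<theta> (\<phi> x))"
    using assms by (auto simp: m_assoc inv_solve_left auto_closed)
  finally show ?thesis .
qed

section \<open>From a pair of \<open>a\<close> and \<open>\<phi>\<close> to an automorphism of the
  n-ary operation\<close>

text \<open>The induction hypothesis is used at \<open>\<theta> x\<close>, hence the generalization
  over \<open>x\<close>; the new factor \<open>(\<theta> ^^ i) a\<close> is then passed by applying
  \<open>\<theta> ^^ i\<close> to \<open>comm\<close>.\<close>

lemma funpow_commutation:
  assumes "\<theta> \<in> auto G" "\<phi> \<in> auto G" "a \<in> carrier G"
    and comm: "\<And>x. x \<in> carrier G \<Longrightarrow> \<phi> (\<theta> x) \<otimes> a = a \<otimes> \<theta> (\<phi> x)"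
    and "x \<in> carrier G"
  shows "\<phi> ((\<theta> ^^ i) x) \<otimes> twisted_prod G \<theta> (\<lambda>_. a) i =
    twisted_prod G \<theta> (\<lambda>_. a) i \<otimes> (\<theta> ^^ i) (\<phi> x)"
  using \<open>x \<in> carrier G\<close>
proof (induction i arbitrary: x)
  case 0
  then show ?case using assms by (simp add: auto_closed)
next
  case (Suc i)
  let ?A = "twisted_prod G \<theta> (\<lambda>_. a)"
  note cl = auto_closed[OF assms(1)] auto_closed[OF assms(2)] funpow_auto_closed[OF assms(1)]
    twisted_prod_closed[OF assms(1)] assms(3) Suc.prems
  have A: "?A (Suc i) = ?A i \<otimes> (\<theta> ^^ i) a"
    by (rule twisted_prod_Suc) (use assms in auto)
  have "\<phi> ((\<theta> ^^ Suc i) x) \<otimes> ?A (Suc i) = \<phi> ((\<theta> ^^ i) (\<theta> x)) \<otimes> ?A i \<otimes> (\<theta> ^^ i) a"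
    by (simp add: A cl m_assoc funpow_swap1)
  also have "\<dots> = ?A i \<otimes> (\<theta> ^^ i) (\<phi> (\<theta> x) \<otimes> a)"
    by (simp add: Suc.IH cl m_assoc funpow_auto_mult assms(1))
  also have "\<dots> = ?A i \<otimes> ((\<theta> ^^ i) a \<otimes> (\<theta> ^^ i) (\<theta> (\<phi> x)))"
    by (simp add: comm cl funpow_auto_mult assms(1))
  also have "\<dots> = ?A (Suc i) \<otimes> (\<theta> ^^ Suc i) (\<phi> x)"
    by (simp add: A cl m_assoc funpow_swap1)
  finally show ?case .
qed

text \<open>In each step the factors \<open>a\<close> collected so far move past
  \<open>(\<theta> ^^ k) (\<phi> (x k))\<close> and turn it into
  \<open>\<phi> ((\<theta> ^^ k) (x k))\<close>, which \<open>\<phi>\<close> absorbs as a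
  homomorphism.\<close>

lemma twisted_prod_translate:
  assumes "\<theta> \<in> auto G" "\<phi> \<in> auto G" "a \<in> carrier G"
    and comm: "\<And>x. x \<in> carrier G \<Longrightarrow> \<phi> (\<theta> x) \<otimes> a = a \<otimes> \<theta> (\<phi> x)"
    and "\<And>i. i < k \<Longrightarrow> x i \<in> carrier G"
  shows "twisted_prod G \<theta> (\<lambda>i. \<phi> (x i) \<otimes> a) k =
    \<phi> (twisted_prod G \<theta> x k) \<otimes> twisted_prod G \<theta> (\<lambda>_. a) k"
  using assms(5)
proof (induction k)
  case 0
  then show ?case using assms by (simp add: auto_one)
next
  case (Suc k)
  let ?A = "twisted_prod G \<theta> (\<lambda>_. a)" and ?P = "twisted_prod G \<theta> x"
  note cl = auto_closed[OF assms(1)] auto_closed[OF assms(2)] funpow_auto_closed[OF assms(1)]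
    twisted_prod_closed[OF assms(1)] assms(3) Suc.prems
  have "twisted_prod G \<theta> (\<lambda>i. \<phi> (x i) \<otimes> a) (Suc k) =
      \<phi> (?P k) \<otimes> ?A k \<otimes> (\<theta> ^^ k) (\<phi> (x k) \<otimes> a)"
    using Suc by (simp add: twisted_prod_Suc assms(1) cl)
  also have "\<dots> = \<phi> (?P k) \<otimes> (?A k \<otimes> (\<theta> ^^ k) (\<phi> (x k))) \<otimes> (\<theta> ^^ k) a"
    by (simp add: cl m_assoc funpow_auto_mult assms(1))
  also have "\<dots> = \<phi> (?P k) \<otimes> (\<phi> ((\<theta> ^^ k) (x k)) \<otimes> ?A k) \<otimes> (\<theta> ^^ k) a"
    by (subst funpow_commutation[OF assms(1-4)]) (simp_all add: cl)
  also have "\<dots> = \<phi> (?P (Suc k)) \<otimes> ?A (Suc k)"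
    by (simp add: twisted_prod_Suc assms(1) cl m_assoc auto_mult[OF assms(2)])
  finally show ?case .
qed

text \<open>Once the translations are collected on the right, the tail is the value of the operation
  at the constant list \<open>a\<close>. By \<open>diag\<close> it is
  \<open>\<phi> b \<otimes> a\<close>, and \<open>\<phi> b\<close> supplies the final factor
  \<open>b\<close> under \<open>\<phi>\<close>.\<close>

lemma der_op_preserved:
  assumes "\<theta> \<in> auto G" "\<phi> \<in> auto G" "a \<in> carrier G" "b \<in> carrier G"
    and "\<And>x. x \<in> carrier G \<Longrightarrow> \<phi> (\<theta> x) \<otimes> a = a \<otimes> \<theta> (\<phi> x)"
    and diag: "der_op G \<theta> b (replicate (length xs) a) = \<phi> b \<otimes> a"
    and xs: "set xs \<subseteq> carrier G"
  shows "der_op G \<theta> b (map (\<lambda>x. \<phi> x \<otimes> a) xs) = \<phi> (der_op G \<theta> b xs) \<otimes> a"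
proof -
  let ?n = "length xs"
  let ?A = "twisted_prod G \<theta> (\<lambda>_. a) ?n" and ?P = "twisted_prod G \<theta> ((!) xs) ?n"
  have nth: "xs ! i \<in> carrier G" if "i < ?n" for i
    using xs that by auto
  have cl: "?A \<in> carrier G" "?P \<in> carrier G" "\<phi> ?P \<in> carrier G" "\<phi> b \<in> carrier G"
    using assms nth by (simp_all add: twisted_prod_closed auto_closed)
  have diag': "?A \<otimes> b = \<phi> b \<otimes> a"
    using diag twisted_prod_cong[of ?n "(!) (replicate ?n a)" "\<lambda>_. a" G \<theta>]
    by (simp add: der_op_eq_twisted_prod)
  have "der_op G \<theta> b (map (\<lambda>x. \<phi> x \<otimes> a) xs) =
      twisted_prod G \<theta> (\<lambda>i. \<phi> (xs ! i) \<otimes> a) ?n \<otimes> b"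
    using twisted_prod_cong[of ?n "(!) (map (\<lambda>x. \<phi> x \<otimes> a) xs)" "\<lambda>i. \<phi> (xs ! i) \<otimes> a" G \<theta>]
    by (simp add: der_op_eq_twisted_prod)
  also have "\<dots> = \<phi> ?P \<otimes> (?A \<otimes> b)"
    using twisted_prod_translate[OF assms(1-3,5) nth] cl assms by (simp add: m_assoc)
  also have "\<dots> = \<phi> (der_op G \<theta> b xs) \<otimes> a"
    using cl assms by (simp add: diag' der_op_eq_twisted_prod m_assoc auto_mult[OF assms(2)])
  finally show ?thesis .
qed

lemma der_op_closed:
  assumes "\<theta> \<in> auto G" "b \<in> carrier G" "set xs \<subseteq> carrier G"
  shows "der_op G \<theta> b xs \<in> carrier G"
  unfolding der_op_eq_twisted_prod using assms by (auto intro!: m_closed twisted_prod_closed)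

lemma translated_auto_in_nary_auto:
  assumes "\<theta> \<in> auto G" "\<phi> \<in> auto G" "a \<in> carrier G" "b \<in> carrier G"
    and "\<And>x. x \<in> carrier G \<Longrightarrow> \<phi> (\<theta> x) \<otimes> a = a \<otimes> \<theta> (\<phi> x)"
    and "der_op G \<theta> b (replicate n a) = \<phi> b \<otimes> a"
  shows "compose (carrier G) (right_translation G a) \<phi> \<in> nary_auto n (carrier G) (der_op G \<theta> b)"
proof -
  let ?\<psi> = "compose (carrier G) (right_translation G a) \<phi>"
  have \<psi>: "?\<psi> x = \<phi> x \<otimes> a" if "x \<in> carrier G" for x
    using that assms by (simp add: compose_def right_translation_def auto_closed)
  have "?\<psi> \<in> Bij (carrier G)"
    using assms by (intro compose_Bij right_translation_Bij auto_Bij)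
  moreover have "?\<psi> (der_op G \<theta> b xs) = der_op G \<theta> b (map ?\<psi> xs)"
    if "length xs = n" "set xs \<subseteq> carrier G" for xs
  proof -
    have map_eq: "map ?\<psi> xs = map (\<lambda>x. \<phi> x \<otimes> a) xs"
      using that by (auto simp: \<psi>)
    show ?thesis
      using der_op_preserved[OF assms(1-5), of xs] der_op_closed[OF assms(1,4)] that assms(6)
      unfolding map_eq by (simp add: \<psi>)
  qed
  ultimately show ?thesis by (simp add: nary_auto_def)
qed

section \<open>Decomposition of an automorphism of the n-ary operation\<close>

text \<open>All conditions are read off from one equation with two free variables, obtained from
  lists \<open>x # y # replicate m \<one>\<close>.\<close>

lemma nary_auto_decompose:
  assumes "n \<ge> 2" "\<theta> \<in> auto G" "b \<in> carrier G"
    and \<psi>: "\<psi> \<in> nary_auto n (carrier G) (der_op G \<theta> b)"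
  obtains a \<phi> where "a \<in> carrier G" "\<phi> \<in> auto G"
    "\<psi> = compose (carrier G) (right_translation G a) \<phi>"
    "der_op G \<theta> b (replicate n a) = \<phi> b \<otimes> a"
    "\<And>x. x \<in> carrier G \<Longrightarrow> \<phi> (\<theta> x) \<otimes> a = a \<otimes> \<theta> (\<phi> x)"
proof -
  let ?C = "carrier G"
  obtain m where n: "n = Suc (Suc m)"
    using assms(1) by (metis Suc_le_D numeral_2_eq_2 Suc_le_mono)
  have \<psi>_f: "\<psi> (der_op G \<theta> b xs) = der_op G \<theta> b (map \<psi> xs)"
    if "length xs = n" "set xs \<subseteq> ?C" for xs
    using \<psi> that by (auto simp: nary_auto_def)
  have \<psi>_Bij: "\<psi> \<in> Bij ?C"
    using \<psi> by (simp add: nary_auto_def)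
  have \<psi>_cl: "\<psi> x \<in> ?C" if "x \<in> ?C" for x
    using \<psi>_Bij Bij_imp_funcset that by blast
  \<comment> \<open>The only possible choice, since an automorphism \<open>\<phi>\<close> fixes
    \<open>\<one>\<close>.\<close>
  define a where "a = \<psi> \<one>"
  define \<phi> where "\<phi> = compose ?C (right_translation G (inv a)) \<psi>"
  have a: "a \<in> ?C" by (simp add: a_def \<psi>_cl)
  have \<phi>_Bij: "\<phi> \<in> Bij ?C"
    unfolding \<phi>_def using a \<psi>_Bij by (simp add: compose_Bij right_translation_Bij)
  have \<phi>_cl: "\<phi> x \<in> ?C" if "x \<in> ?C" for x
    using \<phi>_Bij Bij_imp_funcset that by blast
  have \<phi>: "\<phi> x = \<psi> x \<otimes> inv a" if "x \<in> ?C" for x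
    using that \<psi>_cl by (simp add: \<phi>_def compose_def right_translation_def)
  have \<psi>_eq: "\<psi> x = \<phi> x \<otimes> a" if "x \<in> ?C" for x
    using that a by (simp add: \<phi> m_assoc \<psi>_cl)
  have \<phi>_one: "\<phi> \<one> = \<one>"
    using a by (simp add: \<phi> flip: a_def)
  note \<theta>_cl = auto_closed[OF assms(2)] and \<theta>_mult = auto_mult[OF assms(2)]
  \<comment> \<open>The map \<open>\<psi>\<close> sends the trailing entries \<open>\<one>\<close>
    to \<open>a\<close>, so the tail is \<open>b\<close> before applying \<open>\<psi>\<close> and
    \<open>q\<close> afterwards.\<close>
  obtain q where q: "q \<in> ?C"
    "\<And>x y. x \<in> ?C \<Longrightarrow> y \<in> ?C \<Longrightarrow> der_op G \<theta> b (x # y # replicate m a) = x \<otimes> \<theta> y \<otimes> q"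
    by (rule der_op_two_then_const[OF assms(2) a assms(3), of m]) blast
  have ones: "der_op G \<theta> b (x # y # replicate m \<one>) = x \<otimes> \<theta> y \<otimes> b"
    if "x \<in> ?C" "y \<in> ?C" for x y
    by (rule der_op_two_then_const[OF assms(2) one_closed assms(3), of m]) (use that in auto)
  have eq: "\<phi> (x \<otimes> \<theta> y \<otimes> b) \<otimes> a = \<phi> x \<otimes> (a \<otimes> \<theta> (\<phi> y) \<otimes> \<theta> a \<otimes> q)"
    if "x \<in> ?C" "y \<in> ?C" for x y
  proof -
    have "\<psi> (der_op G \<theta> b (x # y # replicate m \<one>)) =
        der_op G \<theta> b (\<psi> x # \<psi> y # replicate m a)"
      using \<psi>_f[of "x # y # replicate m \<one>"] that by (simp add: n a_def set_replicate_conv_if)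
    then have "\<psi> (x \<otimes> \<theta> y \<otimes> b) = \<psi> x \<otimes> \<theta> (\<psi> y) \<otimes> q"
      using that by (simp add: ones q \<psi>_cl)
    then show ?thesis
      using that a q assms(3) by (simp add: \<psi>_eq \<theta>_cl \<phi>_cl \<theta>_mult m_assoc)
  qed
  have \<phi>_b: "\<phi> b \<otimes> a = a \<otimes> \<theta> a \<otimes> q"
    using eq[of \<one> \<one>] a q assms(3) by (simp add: \<phi>_one auto_one[OF assms(2)] \<theta>_cl)
  have \<phi>_mult: "\<phi> (x \<otimes> z) = \<phi> x \<otimes> \<phi> z" if xz: "x \<in> ?C" "z \<in> ?C" for x z
  proof -
    have "z \<otimes> inv b \<in> \<theta> ` ?C"
      using auto_bij_betw[OF assms(2)] xz assms(3) by (simp add: bij_betw_def)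
    then obtain y where y: "y \<in> ?C" "\<theta> y = z \<otimes> inv b"
      by (metis imageE)
    have z: "z = \<theta> y \<otimes> b"
      using xz assms(3) y(2) by (simp add: m_assoc)
    \<comment> \<open>The right factor in \<open>eq\<close> does not depend on \<open>x\<close>; the
      instance at \<open>\<one>\<close> identifies it as
      \<open>\<phi> z \<otimes> a\<close>.\<close>
    have "\<phi> (x \<otimes> z) \<otimes> a = \<phi> x \<otimes> (\<phi> z \<otimes> a)"
      using eq[of x y] eq[of \<one> y] xz y(1) a q assms(3)
      by (simp add: z \<theta>_cl \<phi>_cl \<phi>_one m_assoc)
    also have "\<dots> = \<phi> x \<otimes> \<phi> z \<otimes> a"
      using xz a by (simp add: m_assoc \<phi>_cl)
    finally show ?thesis
      using a xz by (simp add: \<phi>_cl)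
  qed
  have auto: "\<phi> \<in> auto G"
    using \<phi>_Bij \<phi>_mult \<phi>_cl by (simp add: auto_def hom_def)
  have comm: "\<phi> (\<theta> y) \<otimes> a = a \<otimes> \<theta> (\<phi> y)" if y: "y \<in> ?C" for y
  proof -
    \<comment> \<open>The extra factor \<open>\<theta> a \<otimes> q\<close> makes
      \<open>\<phi>_b\<close> applicable and is cancelled at the end.\<close>
    have "\<phi> (\<theta> y) \<otimes> a \<otimes> (\<theta> a \<otimes> q) = \<phi> (\<theta> y) \<otimes> (\<phi> b \<otimes> a)"
      using y a q by (simp add: \<phi>_b m_assoc \<theta>_cl \<phi>_cl)
    also have "\<dots> = a \<otimes> \<theta> (\<phi> y) \<otimes> (\<theta> a \<otimes> q)"
      using eq[of \<one> y] y a q assms(3) by (simp add: \<phi>_one \<phi>_mult \<theta>_cl \<phi>_cl m_assoc)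
    finally show ?thesis
      using y a q by (simp add: \<theta>_cl \<phi>_cl)
  qed
  have "\<psi> = compose ?C (right_translation G a) \<phi>"
  proof (rule extensionalityI)
    show "\<psi> \<in> extensional ?C"
      using \<psi>_Bij by (simp add: Bij_def)
  qed (simp_all add: compose_def right_translation_def \<psi>_eq \<phi>_cl)
  \<comment> \<open>The constant list is the case of two leading entries \<open>a\<close>, with
    value \<open>a \<otimes> \<theta> a \<otimes> q\<close>.\<close>
  moreover have "der_op G \<theta> b (replicate n a) = \<phi> b \<otimes> a"
    using q(2)[OF a a] by (simp add: n \<phi>_b)
  ultimately show thesis
    using that a auto comm by blast
qed

end

theorem theorem2p7:
  fixes G :: "('a, 'm) monoid_scheme" (structure)
    and n :: nat and \<theta> :: "'a \<Rightarrow> 'a" and b :: 'a and f :: "'a list \<Rightarrow> 'a"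
  assumes "n \<ge> 2"
    and "group G"
    and "\<theta> \<in> auto G"
    and "b \<in> carrier G"
    and "\<theta> b = b"
    and "\<And>x. x \<in> carrier G \<Longrightarrow> (\<theta> ^^ (n - 1)) x = b \<otimes> x \<otimes> inv b"
    and "\<And>xs. length xs = n \<Longrightarrow> set xs \<subseteq> carrier G \<Longrightarrow> f xs = der_op G \<theta> b xs"
  shows "nary_auto n (carrier G) f =
    {compose (carrier G) (right_translation G a) \<phi> | a \<phi>.
       a \<in> carrier G \<and> \<phi> \<in> auto G \<and>
       f (replicate n a) = \<phi> b \<otimes> a \<and>
       commutator (AutoGroup G) \<theta> \<phi> = inner_auto G a}"
proof -
  interpret group G by fact
  \<comment> \<open>The operation \<open>f\<close> is known only on lists of length \<open>n\<close>
    over the carrier. Since \<open>\<psi>\<close> maps such lists to such lists, \<open>f\<close>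
    can be replaced on both sides of the preservation condition.\<close>
  have f_map: "f (map \<psi> xs) = der_op G \<theta> b (map \<psi> xs)"
    if "\<psi> \<in> Bij (carrier G)" "length xs = n" "set xs \<subseteq> carrier G" for \<psi> xs
    using that Bij_imp_funcset[OF that(1)] by (intro assms(7)) auto
  have f_der: "nary_auto n (carrier G) f = nary_auto n (carrier G) (der_op G \<theta> b)"
    unfolding nary_auto_def by (intro Collect_cong conj_cong refl) (auto simp: f_map assms(7))
  have f_diag: "f (replicate n a) = der_op G \<theta> b (replicate n a)" if "a \<in> carrier G" for a
    using that by (intro assms(7)) auto
  show ?thesis
  proof (intro equalityI subsetI)
    fix \<psi> assume "\<psi> \<in> nary_auto n (carrier G) f"
    then have "\<psi> \<in> nary_auto n (carrier G) (der_op G \<theta> b)"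
      by (simp only: f_der)
    then obtain a \<phi> where "a \<in> carrier G" "\<phi> \<in> auto G"
      "\<psi> = compose (carrier G) (right_translation G a) \<phi>"
      "der_op G \<theta> b (replicate n a) = \<phi> b \<otimes> a"
      "\<And>x. x \<in> carrier G \<Longrightarrow> \<phi> (\<theta> x) \<otimes> a = a \<otimes> \<theta> (\<phi> x)"
      using nary_auto_decompose[OF assms(1,3,4)] by metis
    then show "\<psi> \<in> {compose (carrier G) (right_translation G a) \<phi> | a \<phi>.
       a \<in> carrier G \<and> \<phi> \<in> auto G \<and>
       f (replicate n a) = \<phi> b \<otimes> a \<and>
       commutator (AutoGroup G) \<theta> \<phi> = inner_auto G a}"
      by (auto simp: commutator_eq_inner_auto_iff[OF assms(3)] f_diag
          intro!: exI[of _ a] exI[of _ \<phi>])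
  next
    fix \<psi> assume "\<psi> \<in> {compose (carrier G) (right_translation G a) \<phi> | a \<phi>.
       a \<in> carrier G \<and> \<phi> \<in> auto G \<and>
       f (replicate n a) = \<phi> b \<otimes> a \<and>
       commutator (AutoGroup G) \<theta> \<phi> = inner_auto G a}"
    then show "\<psi> \<in> nary_auto n (carrier G) f"
      unfolding f_der
      using translated_auto_in_nary_auto[OF assms(3) _ _ assms(4)]
        commutator_eq_inner_auto_iff[OF assms(3)] f_diag by fastforce
  qed
qed

end
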